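(* Suppose the following assumptions hold. (1) For each $z\in\mathcal Z$, $|c(z,\bar y)-c(z,y)|\le L(z)\|\bar y-y\|$ for all $y,\bar y\in\mathcal Y$, where $\sup_{z\in\mathcal Z}L(z)<+\infty$. (2) For any $\kappa>0$ and a.e. $x\in\mathcal X$ there exist positive constants $K(\kappa,x)$, $\beta(\kappa,x)$ such that $\mathbb P\{\sup_{z\in\mathcal Z}|g_n^*(z;x)-g(z;x)|>\kappa\}\le K(\kappa,x)\exp(-n\beta(\kappa,x))$ for all $n\in\mathbb N$. (3) For any $\kappa>0$ and $n\in\mathbb N$ there exist positive constants $J_Q(\kappa),\gamma_Q(n,\kappa),\bar J_Q(\kappa),\bar\gamma_Q(n,\kappa)$, with $\lim_{n\to\infty}\gamma_Q(n,\kappa)=\lim_{n\to\infty}\bar\gamma_Q(n,\kappa)=\infty$ for each $\kappa>0$, such that $$\mathbb P\Bigl\{\bigl(\tfrac1n\textstyle\sum_{i=1}^n\|[Q^*(x^i)]^{-1}\|^2\bigr)^{1/2}>\bigl(\mathbb E[\|[Q^*(X)]^{-1}\|^2]\bigr)^{1/2}+\kappa\Bigr\}\le J_Q(\kappa)\exp(-\gamma_Q(n,\kappa)),$$ $$\mathbb P\Bigl\{\bigl(\tfrac1n\textstyle\sum_{i=1}^n\|Q^*(x^i)\|^4\bigr)^{1/4}>\bigl(\mathbb E[\|Q^*(X)\|^4]\bigr)^{1/4}+\kappa\Bigr\}\le\bar J_Q(\kappa)\exp(-\bar\gamma_Q(n,\kappa)).$$ (4) For any $\kappa>0$ and $n\in\mathbb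 N$ there exist positive constants $J_\varepsilon(\kappa),\gamma_\varepsilon(n,\kappa),\bar J_\varepsilon(\kappa),\bar\gamma_\varepsilon(n,\kappa)$, with $\lim_{n\to\infty}\gamma_\varepsilon(n,\kappa)=\lim_{n\to\infty}\bar\gamma_\varepsilon(n,\kappa)=\infty$ for each $\kappa>0$, such that $$\mathbb P\Bigl\{\tfrac1n\textstyle\sum_{i=1}^n\|\varepsilon^i\|>\mathbb E[\|\varepsilon\|]+\kappa\Bigr\}\le J_\varepsilon(\kappa)\exp(-\gamma_\varepsilon(n,\kappa)),$$ $$\mathbb P\Bigl\{\bigl(\tfrac1n\textstyle\sum_{i=1}^n\|\varepsilon^i\|^4\bigr)^{1/4}>\bigl(\mathbb E[\|\varepsilon\|^4]\bigr)^{1/4}+\kappa\Bigr\}\le\bar J_\varepsilon(\kappa)\exp(-\bar\gamma_\varepsilon(n,\kappa)).$$ (5) For any $\kappa>0$ and $n\in\mathbb N$ there exist positive constants $K_f(\kappa,x)$, $\bar K_f(\kappa)$, $\beta_f(n,\kappa,x)$, $\bar\beta_f(n,\kappa)$, $K_Q(\kappa,x)$, $\bar K_Q(\kappa)$, $\beta_Q(n,\kappa,x)$, $\bar\beta_Q(n,\kappa)$, with $\beta_f(n,\kappa,x)$, $\bar\beta_f(n,\kappa)$, $\beta_Q(n,\kappa,x)$ and $\bar\beta_Q(n,\kappa)$ all tending to $\infty$ as $n\to\infty$ for each $\kappa>0$ and a.e. $x\in\mathcal X$, such that (a) $\mathbb P\{\|f^*(x)-\hat f_n(x)\|>\kappa\}\le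 K_f(\kappa,x)\exp(-\beta_f(n,\kappa,x))$ for a.e. $x\in\mathcal X$; (b) $\mathbb P\{\frac1n\sum_{i=1}^n\|f^*(x^i)-\hat f_n(x^i)\|^2>\kappa^2\}\le\bar K_f(\kappa)\exp(-\bar\beta_f(n,\kappa))$; (c) $\mathbb P\{\|Q^*(x)-\hat Q_n(x)\|>\kappa\}\le K_Q(\kappa,x)\exp(-\beta_Q(n,\kappa,x))$ for a.e. $x\in\mathcal X$; (d) $\mathbb P\{\frac1n\sum_{i=1}^n\|[\hat Q_n(x^i)]^{-1}-[Q^*(x^i)]^{-1}\|^2>\kappa^2\}\le\bar K_Q(\kappa)\exp(-\bar\beta_Q(n,\kappa))$. Then, for each $n\in\mathbb N$ and a.e. $x\in\mathcal X$, given $\eta>0$, there exist constants $Q(\eta,x)>0$ (not depending on $n$) and $\gamma(n,\eta,x)>0$, with $\lim_{n\to\infty}\gamma(n,\eta,x)=\infty$ for each $\eta>0$ and a.e. $x\in\mathcal X$, such that $$\mathbb P\{\operatorname{dist}(\hat z_n^{ER}(x),S^*(x))\ge\eta\}\le Q(\eta,x)\exp(-\gamma(n,\eta,x)).$$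
   Context: Setting. $X$ is a random vector of covariates with distribution $P_X$ and support $\mathcal X\subseteq\mathbb R^{d_x}$; $Y$ is a random vector with (closed) support $\mathcal Y\subseteq\mathbb R^{d_y}$, which is assumed nonempty and convex. $\mathcal Z\subset\mathbb R^{d_z}$ is nonempty and compact and $c:\mathcal Z\times\mathcal Y\to\mathbb R$. It is assumed that $Y=f^*(X)+Q^*(X)\varepsilon$, where $f^*(x)=\mathbb E[Y\mid X=x]$, $Q^*(\bar x)\in\mathbb R^{d_y\times d_y}$ is positive definite for all $\bar x\in\mathcal X$, and $\varepsilon$ is a zero-mean random vector independent of $X$ with distribution $P_\varepsilon$ and support $\Xi\subseteq\mathbb R^{d_y}$. True problem: $v^*(x):=\min_{z\in\mathcal Z}\{g(z;x):=\mathbb E[c(z,f^*(x)+Q^*(x)\varepsilon)]\}$ (expectation over $\varepsilon\sim P_\varepsilon$), with optimal solution set $S^*(x)$. It is assumed that $\mathbb E[|c(z,f^*(x)+Q^*(x)\varepsilon)|]<+\infty$ for each $z\in\mathcal Z$ and a.e. $x\in\mathcal X$, and that $g(\cdot;x)$ is lower semicontinuous on $\mathcal Z$ for a.e. $x\in\mathcal X$. Data: $\mathcal D_n=\{(y^i,x^i)\}_{i=1}^n$ are joint observations of $(Y,X)$ (not assumed i.i.d. unless stated), and $\varepsilon^i:=[Q^*(x^i)]^{-1}(y^i-f^*(x^i))$ are the corresponding error realizations. Full-information SAA objective: $g_n^*(z;x):=\frac1n\sum_{i=1}^n c(z,f^*(x)+Q^*(x)\varepsilon^i)$; for a.e. $x$,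 the points $f^*(x)+Q^*(x)\varepsilon^i$ lie in $\mathcal Y$ almost surely. Estimates: $\hat f_n:\mathcal X\to\mathbb R^{d_y}$ and $\hat Q_n:\mathcal X\to\mathbb R^{d_y\times d_y}$ (with $\hat Q_n(\bar x)$ nonsingular for all $\bar x\in\mathcal X$) are estimates of $f^*$ and $Q^*$ computed from $\mathcal D_n$. Empirical residuals: $\hat\varepsilon_n^i:=[\hat Q_n(x^i)]^{-1}(y^i-\hat f_n(x^i))$. With $\operatorname{proj}_{\mathcal Y}$ the orthogonal projection onto $\mathcal Y$, the empirical-residuals SAA (ER-SAA) problem is $$\hat v_n^{ER}(x):=\min_{z\in\mathcal Z}\Bigl\{\hat g_n^{ER}(z;x):=\frac1n\sum_{i=1}^n c\bigl(z,\operatorname{proj}_{\mathcal Y}(\hat f_n(x)+\hat Q_n(x)\hat\varepsilon_n^i)\bigr)\Bigr\}.$$ Its optimal solution set is assumed nonempty for a.e. $x\in\mathcal X$, and $\hat z_n^{ER}(x)$ denotes an optimal solution. Conventions: $\|\cdot\|$ is the Euclidean norm or its induced matrix norm; "a.e. $x\in\mathcal X$" is with respect to $P_X$; $\mathbb P$ refers to the measure generating the data; all functions, sets and selections are assumed measurable; the expectations appearing in the assumptions are finite. $\operatorname{dist}(v,B):=\inf_{w\in B}\|v-w\|$. Constants whose displayed arguments do not include $n$ do not depend on $n$. *)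

theory Defs
  imports "HOL-Probability.Probability"
begin

section \<open>Generic notions\<close>

definition topological_support :: "'a::topological_space measure \<Rightarrow> 'a set" where
  "topological_support \<mu> = {x. \<forall>U. open U \<and> x \<in> U \<longrightarrow> 0 < emeasure \<mu> U}"

text \<open>The norm of the type \<^typ>\<open>real^'n^'m\<close> is the Frobenius norm; this is the matrix norm
  induced by the Euclidean norm.\<close>

definition op_norm :: "real^'n^'m \<Rightarrow> real" where
  "op_norm A = onorm (\<lambda>v. A *v v)"

text \<open>Symmetry is not part of this definition, so that it covers both usages of
  ``positive definite''.\<close>

definition pos_definite :: "real^'n^'n \<Rightarrow> bool" where
  "pos_definite A \<longleftrightarrow> (\<forall>v. v \<noteq> 0 \<longrightarrow> 0 < v \<bullet> (A *v v))"

definition lsc_on :: "'a::topological_space set \<Rightarrow> ('a \<Rightarrow> real) \<Rightarrow> bool" where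
  "lsc_on S h \<longleftrightarrow> (\<forall>z\<in>S. ereal (h z) \<le> Liminf (at z within S) (\<lambda>u. ereal (h u)))"

definition argmin_set :: "'a set \<Rightarrow> ('a \<Rightarrow> real) \<Rightarrow> 'a set" where
  "argmin_set S h = {z. is_arg_min h (\<lambda>u. u \<in> S) z}"

text \<open>Sample sizes are \<open>n \<ge> 1\<close>. The constant \<open>K\<close> may not depend on \<open>n\<close>, the rate \<open>\<beta>\<close> may.\<close>

definition exp_tail :: "(nat \<Rightarrow> real) \<Rightarrow> bool" where
  "exp_tail p \<longleftrightarrow> (\<exists>K>0. \<exists>\<beta>::nat \<Rightarrow> real.
      (\<forall>n\<ge>1. 0 < \<beta> n) \<and> filterlim \<beta> at_top sequentially \<and>
      (\<forall>n\<ge>1. p n \<le> K * exp (- \<beta> n)))"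

section \<open>Sample average approximations with residuals\<close>

type_synonym ('y, 'x) dataset = "nat \<Rightarrow> (real^'y) \<times> (real^'x)"

text \<open>The data set of the first \<open>n\<close> observations, indexed by \<open>1, \<dots>, n\<close>, as an element of the
  product space over \<open>{1..n}\<close>.\<close>

definition sample ::
    "(nat \<Rightarrow> 'w \<Rightarrow> real^'y) \<Rightarrow> (nat \<Rightarrow> 'w \<Rightarrow> real^'x) \<Rightarrow> nat \<Rightarrow> 'w \<Rightarrow> ('y, 'x) dataset" where
  "sample ys xs n \<omega> = (\<lambda>i\<in>{1..n}. (ys i \<omega>, xs i \<omega>))"

text \<open>With \<open>(f, Q)\<close> the true pair this is the realised error, with the estimates it is the
  empirical residual.\<close>

definition residual ::
    "(real^'x \<Rightarrow> real^'y) \<Rightarrow> (real^'x \<Rightarrow> real^'y^'y) \<Rightarrow> real^'y \<Rightarrow> real^'x \<Rightarrow> real^'y" where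
  "residual f Q y x = matrix_inv (Q x) *v (y - f x)"

definition true_obj ::
    "(real^'z \<Rightarrow> real^'y \<Rightarrow> real) \<Rightarrow> (real^'y) measure \<Rightarrow> (real^'x \<Rightarrow> real^'y) \<Rightarrow>
     (real^'x \<Rightarrow> real^'y^'y) \<Rightarrow> real^'z \<Rightarrow> real^'x \<Rightarrow> real" where
  "true_obj c P\<epsilon> f Q z x = (\<integral>e. c z (f x + Q x *v e) \<partial>P\<epsilon>)"

definition saa_obj ::
    "(real^'z \<Rightarrow> real^'y \<Rightarrow> real) \<Rightarrow> (real^'x \<Rightarrow> real^'y) \<Rightarrow> (real^'x \<Rightarrow> real^'y^'y) \<Rightarrow>
     nat \<Rightarrow> ('y, 'x) dataset \<Rightarrow> real^'z \<Rightarrow> real^'x \<Rightarrow> real" where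
  "saa_obj c f Q n d z x =
     (1 / real n) * (\<Sum>i=1..n. c z (f x + Q x *v residual f Q (fst (d i)) (snd (d i))))"

text \<open>Here \<open>f\<close> and \<open>Q\<close> are the estimates computed from \<open>d\<close>; \<^const>\<open>closest_point\<close> is the
  orthogonal projection, since the set \<open>Y\<close> is always closed, convex and nonempty below.\<close>

definition er_saa_obj ::
    "(real^'z \<Rightarrow> real^'y \<Rightarrow> real) \<Rightarrow> (real^'y) set \<Rightarrow> (real^'x \<Rightarrow> real^'y) \<Rightarrow>
     (real^'x \<Rightarrow> real^'y^'y) \<Rightarrow> nat \<Rightarrow> ('y, 'x) dataset \<Rightarrow> real^'z \<Rightarrow> real^'x \<Rightarrow> real" where
  "er_saa_obj c Y f Q n d z x =
     (1 / real n) *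
     (\<Sum>i=1..n. c z (closest_point Y (f x + Q x *v residual f Q (fst (d i)) (snd (d i)))))"

section \<open>Standing assumptions\<close>

text \<open>The model variables \<open>X\<close>, \<open>Y\<close>, \<open>\<epsilon>\<close> live on \<open>N\<close>; the data, and hence all
  random estimates, live on \<open>M\<close>. The functions \<open>c\<close>, \<open>fs\<close>, \<open>Qs\<close>, \<open>fh\<close>, \<open>Qh\<close>
  matter only on \<open>\<Z> \<times> \<Y>\<close> and \<open>\<X>\<close>; these sets are closed, so requiring
  measurability on the whole space is no restriction (extend by a constant).
  The estimates \<open>fh n\<close>, \<open>Qh n\<close> are functions of the data set.\<close>

locale er_saa = N: prob_space N + M: prob_space M
  for N :: "'a measure" and M :: "'w measure" +
  fixes X :: "'a \<Rightarrow> real^'x::finite" and Y :: "'a \<Rightarrow> real^'y::finite" and \<epsilon> :: "'a \<Rightarrow> real^'y"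
    and P\<^sub>X :: "(real^'x) measure" and P\<^sub>\<epsilon> :: "(real^'y) measure"
    and \<X> :: "(real^'x) set" and \<Y> :: "(real^'y) set" and \<Z> :: "(real^'z::finite) set"
    and c :: "real^'z \<Rightarrow> real^'y \<Rightarrow> real"
    and fs :: "real^'x \<Rightarrow> real^'y" and Qs :: "real^'x \<Rightarrow> real^'y^'y"
    and ys :: "nat \<Rightarrow> 'w \<Rightarrow> real^'y" and xs :: "nat \<Rightarrow> 'w \<Rightarrow> real^'x"
    and fh :: "nat \<Rightarrow> ('y, 'x) dataset \<Rightarrow> real^'x \<Rightarrow> real^'y"
    and Qh :: "nat \<Rightarrow> ('y, 'x) dataset \<Rightarrow> real^'x \<Rightarrow> real^'y^'y"
    and zh :: "nat \<Rightarrow> 'w \<Rightarrow> real^'x \<Rightarrow> real^'z"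
  assumes X_measurable: "X \<in> borel_measurable N"
    and Y_measurable: "Y \<in> borel_measurable N"
    and eps_measurable: "\<epsilon> \<in> borel_measurable N"
    and P_X: "P\<^sub>X = distr N borel X"
    and P_eps: "P\<^sub>\<epsilon> = distr N borel \<epsilon>"
    and X_support: "\<X> = topological_support P\<^sub>X"
    and Y_support: "\<Y> = topological_support (distr N borel Y)"
    and Y_support_nonempty: "\<Y> \<noteq> {}"
    and Y_support_convex: "convex \<Y>"
    and Z_nonempty: "\<Z> \<noteq> {}"
    and Z_compact: "compact \<Z>"
    and c_measurable: "(\<lambda>(z, y). c z y) \<in> borel_measurable (borel \<Otimes>\<^sub>M borel)"
    and fs_measurable: "fs \<in> borel_measurable borel"
    and Qs_measurable: "Qs \<in> borel_measurable borel"
    and model: "AE a in N. Y a = fs (X a) + Qs (X a) *v \<epsilon> a"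
    and Y_integrable: "integrable N Y"
    and fs_regression: "\<And>j. AE a in N. fs (X a) $ j =
          real_cond_exp N (vimage_algebra (space N) X borel) (\<lambda>a. Y a $ j) a"
    and Qs_pos_definite: "\<And>x. x \<in> \<X> \<Longrightarrow> pos_definite (Qs x)"
    and eps_integrable: "integrable N \<epsilon>"
    and eps_mean: "integral\<^sup>L N \<epsilon> = 0"
    and eps_indep_X: "N.indep_set (sets (vimage_algebra (space N) \<epsilon> borel))
          (sets (vimage_algebra (space N) X borel))"
    and c_integrable: "\<And>z. z \<in> \<Z> \<Longrightarrow> AE x\<in>\<X> in P\<^sub>X. integrable P\<^sub>\<epsilon> (\<lambda>e. c z (fs x + Qs x *v e))"
    and g_lsc: "AE x\<in>\<X> in P\<^sub>X. lsc_on \<Z> (\<lambda>z. true_obj c P\<^sub>\<epsilon> fs Qs z x)"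
    and xs_measurable: "\<And>i. 1 \<le> i \<Longrightarrow> xs i \<in> borel_measurable M"
    and ys_measurable: "\<And>i. 1 \<le> i \<Longrightarrow> ys i \<in> borel_measurable M"
    and xs_in: "\<And>i. 1 \<le> i \<Longrightarrow> AE \<omega> in M. xs i \<omega> \<in> \<X>"
    and ys_in: "\<And>i. 1 \<le> i \<Longrightarrow> AE \<omega> in M. ys i \<omega> \<in> \<Y>"
    and scenario_in: "\<And>i. 1 \<le> i \<Longrightarrow> AE x\<in>\<X> in P\<^sub>X. AE \<omega> in M.
          fs x + Qs x *v residual fs Qs (ys i \<omega>) (xs i \<omega>) \<in> \<Y>"
    and sup_measurable: "\<And>n. 1 \<le> n \<Longrightarrow> AE x\<in>\<X> in P\<^sub>X.
          (\<lambda>\<omega>. SUP z\<in>\<Z>. ereal \<bar>saa_obj c fs Qs n (sample ys xs n \<omega>) z x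
                                - true_obj c P\<^sub>\<epsilon> fs Qs z x\<bar>) \<in> borel_measurable M"
    and fh_measurable: "\<And>n. 1 \<le> n \<Longrightarrow>
          (\<lambda>(d, x). fh n d x) \<in> borel_measurable ((\<Pi>\<^sub>M i\<in>{1..n}. borel) \<Otimes>\<^sub>M borel)"
    and Qh_measurable: "\<And>n. 1 \<le> n \<Longrightarrow>
          (\<lambda>(d, x). Qh n d x) \<in> borel_measurable ((\<Pi>\<^sub>M i\<in>{1..n}. borel) \<Otimes>\<^sub>M borel)"
    and Qh_nonsingular: "\<And>n. 1 \<le> n \<Longrightarrow>
          AE \<omega> in M. \<forall>x\<in>\<X>. invertible (Qh n (sample ys xs n \<omega>) x)"
    and zh_measurable: "\<And>n. 1 \<le> n \<Longrightarrow> AE x\<in>\<X> in P\<^sub>X. (\<lambda>\<omega>. zh n \<omega> x) \<in> borel_measurable M"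
    and zh_optimal: "\<And>n. 1 \<le> n \<Longrightarrow> AE x\<in>\<X> in P\<^sub>X. AE \<omega> in M.
          zh n \<omega> x \<in> argmin_set \<Z> (\<lambda>z. er_saa_obj c \<Y> (fh n (sample ys xs n \<omega>))
            (Qh n (sample ys xs n \<omega>)) n (sample ys xs n \<omega>) z x)"

end

theory Submission
  imports Defs
begin

text \<open>
A minimiser of a function that is uniformly close to \<open>g\<close> is a near-minimiser of \<open>g\<close>, and near-minimisers of
a lower semicontinuous function on a compact set are close to the set of minimisers
(\<open>lsc_on_growth\<close>). More precisely, for \<open>\<eta> > 0\<close> there is \<open>\<kappa> > 0\<close> such that every point at distance at least
\<open>\<eta>\<close> from the solution set has a true objective value at least \<open>\<kappa>\<close> above the optimum. The estimated solution can
be that far off only if the empirical-residuals objective deviates from \<open>g\<close> by at least \<open>\<kappa> / 2\<close> somewhere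
on the feasible set. So it suffices to make this uniform deviation exponentially unlikely.

The deviation splits at the full-information sample average, whose distance to \<open>g\<close> is controlled by hypothesis.
The remaining part is deterministic (\<open>er_saa_obj_error_uniform\<close>). By the Lipschitz condition it is at most a
multiple of the mean distance between the estimated and the true scenarios, and the projection does not increase
these distances because the true scenarios lie in the convex support. Writing \<open>a\<close>, \<open>q\<close>, \<open>b\<close> for the norms of
the error of the estimated inverse, of the true scaling matrix and of its inverse at a data point, \<open>e\<close> for the
norm of the true error and \<open>r\<close> for the error of the regression estimate there, the empirical residual is off by
at most \<open>a q e + (a + b) r\<close> (\<open>residual_error\<close>). Cauchy-Schwarz bounds the mean of this in terms of the second
moments of \<open>a\<close>, \<open>b\<close>, \<open>r\<close> and the fourth moments of \<open>q\<close>, \<open>e\<close>. The moments of \<open>b\<close>, \<open>q\<close>, \<open>e\<close> are bounded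
and those of \<open>a\<close> and \<open>r\<close> are small, in each case outside of an exponentially unlikely event.

Thus the estimated solution is far off only on a union of nine exponentially unlikely events, up to a null
set, and such unions are exponentially unlikely (\<open>exp_unlikely_disj\<close>).
\<close>

section \<open>Operator norms and inverses of matrices\<close>

lemma op_norm_bound: "norm (A *v v) \<le> op_norm A * norm v"
  unfolding op_norm_def by (rule onorm) simp

lemma op_norm_nonneg: "0 \<le> op_norm A"
  unfolding op_norm_def by (rule onorm_pos_le) simp

lemma op_norm_triangle: "op_norm (A + B) \<le> op_norm A + op_norm B"
  unfolding op_norm_def matrix_vector_mult_add_rdistrib by (rule onorm_triangle) simp_all

lemma op_norm_minus_commute: "op_norm (A - B) = op_norm (B - A)"
proof -
  have "(\<lambda>v. (A - B) *v v) = (\<lambda>v. - ((B - A) *v v))"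
    by (simp add: matrix_vector_mult_diff_rdistrib)
  then show ?thesis
    unfolding op_norm_def by (simp only: onorm_neg)
qed

lemma op_norm_le_add_diff: "op_norm A \<le> op_norm (A - B) + op_norm B"
  using op_norm_triangle[of "A - B" B] by simp

lemma op_norm_scaleR: "op_norm (r *\<^sub>R A) = \<bar>r\<bar> * op_norm A"
  unfolding op_norm_def scaleR_matrix_vector_assoc[symmetric] by (rule onorm_scaleR) simp

text \<open>A norm is convex, and a finite convex function on a Euclidean space is continuous.\<close>

lemma op_norm_measurable: "op_norm \<in> borel_measurable borel"
proof -
  have "convex_on UNIV op_norm"
  proof (rule convex_onI)
    fix t :: real and A B :: "real^'n^'m"
    assume "0 < t" "t < 1"
    then show "op_norm ((1 - t) *\<^sub>R A + t *\<^sub>R B) \<le> (1 - t) * op_norm A + t * op_norm B"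
      using op_norm_triangle[of "(1 - t) *\<^sub>R A" "t *\<^sub>R B"] by (simp add: op_norm_scaleR)
  qed simp
  then show ?thesis
    by (intro borel_measurable_continuous_onI convex_on_continuous) simp_all
qed

lemma matrix_inv_works:
  assumes "invertible A"
  shows "A ** matrix_inv A = mat 1" "matrix_inv A ** A = mat 1"
  using someI_ex[OF assms[unfolded invertible_def]] unfolding matrix_inv_def by auto

text \<open>The \<open>j\<close>-th column of the inverse solves \<open>A v = e\<^sub>j\<close>. Cramer's rule thus exhibits the inverse as a
continuous function of the entries wherever the determinant does not vanish.\<close>

lemma matrix_inv_eq_cramer:
  fixes A :: "real^'n^'n"
  assumes "det A \<noteq> 0"
  shows "matrix_inv A =
    (\<chi> k j. det (\<chi> i l. if l = k then axis j 1 $ i else A $ i $ l) / det A)"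
proof -
  have "A ** matrix_inv A = mat 1"
    using assms by (simp add: invertible_det_nz matrix_inv_works)
  then have "A *v (matrix_inv A *v axis j 1) = axis j 1" for j
    by (simp add: matrix_vector_mul_assoc)
  then have "matrix_inv A *v axis j 1 =
      (\<chi> k. det (\<chi> i l. if l = k then axis j 1 $ i else A $ i $ l) / det A)" for j
    using cramer[OF assms, of "matrix_inv A *v axis j 1" "axis j 1"] by simp
  then show ?thesis
    by (simp add: matrix_vector_mult_basis column_def vec_eq_iff)
qed

lemma continuous_on_det:
  fixes F :: "'a::topological_space \<Rightarrow> real^'n^'n"
  assumes "continuous_on S F"
  shows "continuous_on S (\<lambda>x. det (F x))"
  unfolding det_def using assms by (intro continuous_intros)

text \<open>Off the singular matrices this is Cramer's rule. The inverse of a singular matrix is a choice from the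
empty set of candidates, hence the same matrix for all of them, so that the two pieces together are
measurable.\<close>

lemma matrix_inv_measurable:
  "matrix_inv \<in> borel_measurable (borel :: (real^'n^'n) measure)"
proof -
  let ?S = "{A :: real^'n^'n. det A \<noteq> 0}"
  let ?C = "\<lambda>A :: real^'n^'n. \<chi> k j. det (\<chi> i l. if l = k then axis j 1 $ i else A $ i $ l) / det A"
  let ?D = "SOME A' :: real^'n^'n. False"
  have singular: "matrix_inv A = ?D" if "det A = 0" for A :: "real^'n^'n"
  proof -
    have "(A ** A' = mat 1 \<and> A' ** A = mat 1) = False" for A'
      using that invertible_det_nz[of A] unfolding invertible_def by blast
    then show ?thesis
      unfolding matrix_inv_def by (simp only:)
  qed
  have "open ?S"
    by (intro open_Collect_neq continuous_on_det continuous_intros)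
  moreover have "continuous_on ?S ?C"
    apply (intro continuous_on_det continuous_intros)
    subgoal for k j i l
      by (cases "l = k") (auto intro!: continuous_intros)
    by simp
  ultimately have "(\<lambda>A. if A \<in> ?S then ?C A else ?D) \<in> borel_measurable borel"
    by (intro borel_measurable_continuous_on_if) auto
  moreover have "(\<lambda>A. if A \<in> ?S then ?C A else ?D) = matrix_inv"
    by (intro ext) (simp add: matrix_inv_eq_cramer singular)
  ultimately show ?thesis
    by simp
qed

lemma pos_definite_imp_invertible: "pos_definite A \<Longrightarrow> invertible A"
  unfolding pos_definite_def invertible_left_inverse matrix_left_invertible_ker
  by (metis inner_zero_right less_irrefl)

section \<open>Growth of lower semicontinuous functions away from their minimisers\<close>

lemma lsc_on_superlevel_nhd:
  assumes "lsc_on S h" "z \<in> S" "r < h z"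
  obtains U where "open U" "z \<in> U" "\<And>u. u \<in> U \<Longrightarrow> u \<in> S \<Longrightarrow> r < h u"
proof -
  have "ereal (h z) \<le> Liminf (at z within S) (\<lambda>u. ereal (h u))"
    using assms by (auto simp: lsc_on_def)
  moreover have "ereal r < ereal (h z)"
    using assms by simp
  ultimately have "eventually (\<lambda>u. ereal r < ereal (h u)) (at z within S)"
    unfolding le_Liminf_iff by blast
  then obtain U where "open U" "z \<in> U" "\<forall>u\<in>U. u \<noteq> z \<longrightarrow> u \<in> S \<longrightarrow> r < h u"
    unfolding eventually_at_topological by auto
  then show thesis
    using that assms(3) by metis
qed

text \<open>If every \<open>z\<close> in \<open>T\<close> were beaten by some \<open>w z\<close>, lower semicontinuity would let \<open>w z\<close> beat a whole
neighbourhood of \<open>z\<close>. Finitely many of these neighbourhoods cover \<open>T\<close>, and the best of the finitely many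
winners lies in one of them, so it is beaten by another winner.\<close>

lemma lsc_on_attains_min:
  assumes "lsc_on S h" "T \<subseteq> S" "compact T" "T \<noteq> {}"
  obtains z where "z \<in> T" "\<And>u. u \<in> T \<Longrightarrow> h z \<le> h u"
proof (rule ccontr)
  assume "\<not> thesis"
  then have "\<forall>z\<in>T. \<exists>w. w \<in> T \<and> h w < h z"
    using that by (meson not_le)
  then obtain w where w: "\<And>z. z \<in> T \<Longrightarrow> w z \<in> T \<and> h (w z) < h z"
    by metis
  have "\<exists>U. open U \<and> z \<in> U \<and> (\<forall>u\<in>U. u \<in> S \<longrightarrow> h (w z) < h u)" if "z \<in> T" for z
  proof -
    have "z \<in> S" "h (w z) < h z"
      using that w[OF that] assms(2) by auto
    then show ?thesis
      by (rule lsc_on_superlevel_nhd[OF assms(1)]) auto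
  qed
  then have "\<exists>U. \<forall>z\<in>T. open (U z) \<and> z \<in> U z \<and> (\<forall>u\<in>U z. u \<in> S \<longrightarrow> h (w z) < h u)"
    by (intro bchoice) blast
  then obtain U where U: "\<And>z. z \<in> T \<Longrightarrow> open (U z)" "\<And>z. z \<in> T \<Longrightarrow> z \<in> U z"
    "\<And>z u. z \<in> T \<Longrightarrow> u \<in> U z \<Longrightarrow> u \<in> S \<Longrightarrow> h (w z) < h u"
    by blast
  obtain D where D: "D \<subseteq> T" "finite D" "T \<subseteq> (\<Union>z\<in>D. U z)"
    using compactE_image[OF assms(3), of T U] U(1,2) by blast
  with assms(4) have "D \<noteq> {}"
    by auto
  then obtain d where d: "d \<in> D" "\<And>e. e \<in> D \<Longrightarrow> h (w d) \<le> h (w e)"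
    using arg_min_if_finite[OF D(2), of "\<lambda>z. h (w z)"] by (auto simp: not_less)
  have "w d \<in> T"
    using d(1) D(1) w[of d] by auto
  then obtain e where "e \<in> D" "w d \<in> U e"
    using D by blast
  then have "h (w e) < h (w d)"
    using U(3)[of e "w d"] D(1) assms(2) \<open>w d \<in> T\<close> by blast
  then show False
    using d(2)[OF \<open>e \<in> D\<close>] by simp
qed

text \<open>This turns a distance to the set of minimisers into a gap in value: the points of \<open>S\<close> at distance at
least \<open>\<eta>\<close> from the minimisers form a compact set, whose own minimum exceeds the global one.\<close>

lemma lsc_on_growth:
  assumes "lsc_on S h" "compact S" "S \<noteq> {}" "0 < \<eta>"
  obtains z\<^sub>0 \<kappa> where "z\<^sub>0 \<in> S" "0 < \<kappa>"
    "\<And>z. z \<in> S \<Longrightarrow> \<eta> \<le> infdist z (argmin_set S h) \<Longrightarrow> h z\<^sub>0 + \<kappa> \<le> h z"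
proof -
  obtain z\<^sub>0 where z0: "z\<^sub>0 \<in> S" "\<And>u. u \<in> S \<Longrightarrow> h z\<^sub>0 \<le> h u"
    using lsc_on_attains_min[OF assms(1) subset_refl assms(2,3)] by blast
  let ?T = "S \<inter> {z. \<eta> \<le> infdist z (argmin_set S h)}"
  show thesis
  proof (cases "?T = {}")
    case True
    \<comment> \<open>No point is far from the minimisers, so any positive gap will do.\<close>
    then show thesis
      using that[OF z0(1), of 1] by auto
  next
    case False
    have "compact ?T"
      by (intro compact_Int_closed assms closed_Collect_le continuous_intros)
    then obtain z\<^sub>1 where z1: "z\<^sub>1 \<in> ?T" "\<And>u. u \<in> ?T \<Longrightarrow> h z\<^sub>1 \<le> h u"
      using lsc_on_attains_min[OF assms(1) _ _ False] by blast
    have "z\<^sub>1 \<notin> argmin_set S h"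
      using z1(1) assms(4) by auto
    then have "h z\<^sub>0 < h z\<^sub>1"
      using z0 z1(1) unfolding argmin_set_def is_arg_min_linorder by force
    then show thesis
      using that[OF z0(1), of "h z\<^sub>1 - h z\<^sub>0"] z1(2) by auto
  qed
qed

section \<open>Exponentially unlikely events\<close>

text \<open>The slower of the two rates still tends to infinity. This is what makes exponential tails stable under
finite unions of events.\<close>

lemma exp_tail_add:
  assumes "exp_tail p" "exp_tail q" "\<And>n. 1 \<le> n \<Longrightarrow> r n \<le> p n + q n"
  shows "exp_tail r"
proof -
  obtain K \<beta> where p: "0 < K" "\<forall>n\<ge>1. 0 < \<beta> n" "filterlim \<beta> at_top sequentially"
    "\<forall>n\<ge>1. p n \<le> K * exp (- \<beta> n)"
    using assms(1) unfolding exp_tail_def by blast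
  obtain K' \<beta>' where q: "0 < K'" "\<forall>n\<ge>1. 0 < \<beta>' n" "filterlim \<beta>' at_top sequentially"
    "\<forall>n\<ge>1. q n \<le> K' * exp (- \<beta>' n)"
    using assms(2) unfolding exp_tail_def by blast
  let ?m = "\<lambda>n. min (\<beta> n) (\<beta>' n)"
  have "filterlim ?m at_top sequentially"
    using p(3) q(3) unfolding filterlim_at_top by (auto intro: eventually_conj)
  moreover have "r n \<le> (K + K') * exp (- ?m n)" if "1 \<le> n" for n
  proof -
    have "p n \<le> K * exp (- \<beta> n)" "q n \<le> K' * exp (- \<beta>' n)"
      using p q that by auto
    moreover have "K * exp (- \<beta> n) \<le> K * exp (- ?m n)" "K' * exp (- \<beta>' n) \<le> K' * exp (- ?m n)"
      using p(1) q(1) by simp_all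
    ultimately show ?thesis
      using assms(3)[OF that] by (simp add: algebra_simps)
  qed
  ultimately show ?thesis
    unfolding exp_tail_def using p(1,2) q(1,2)
    by (intro exI[of _ "K + K'"] conjI exI[of _ ?m]) auto
qed

lemma exp_tail_mono:
  assumes "exp_tail p" "\<And>n. 1 \<le> n \<Longrightarrow> q n \<le> p n"
  shows "exp_tail q"
  using assms unfolding exp_tail_def by (meson order_trans)

lemma exp_tail_linear_rate:
  assumes "0 < K" "0 < \<beta>" "\<And>n. 1 \<le> n \<Longrightarrow> p n \<le> K * exp (- (real n * \<beta>))"
  shows "exp_tail p"
proof -
  have "filterlim (\<lambda>n. real n * \<beta>) at_top sequentially"
    using filterlim_tendsto_pos_mult_at_top[OF tendsto_const assms(2) filterlim_real_sequentially]
    by (simp only: mult.commute)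
  moreover have "\<forall>n\<ge>1. 0 < real n * \<beta>"
    using assms(2) by simp
  ultimately have "(\<forall>n\<ge>1. 0 < real n * \<beta>) \<and> filterlim (\<lambda>n. real n * \<beta>) at_top sequentially \<and>
      (\<forall>n\<ge>1. p n \<le> K * exp (- (real n * \<beta>)))"
    by (simp add: assms(3) del: zero_less_mult_iff)
  then show ?thesis
    unfolding exp_tail_def using assms(1)
    by (intro exI[of _ K] conjI exI[of _ "\<lambda>n. real n * \<beta>"]) simp_all
qed

text \<open>Measurability is part of the notion: \<^const>\<open>measure\<close> is \<open>0\<close> on nonmeasurable sets, so a bound on the
probability of a nonmeasurable event would say nothing about the events contained in it.\<close>

definition exp_unlikely :: "'w measure \<Rightarrow> (nat \<Rightarrow> 'w \<Rightarrow> bool) \<Rightarrow> bool" where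
  "exp_unlikely M E \<longleftrightarrow>
     (\<forall>n\<ge>1. {\<omega> \<in> space M. E n \<omega>} \<in> sets M) \<and> exp_tail (\<lambda>n. \<P>(\<omega> in M. E n \<omega>))"

lemma exp_unlikelyI:
  assumes "\<And>n. 1 \<le> n \<Longrightarrow> {\<omega> \<in> space M. E n \<omega>} \<in> sets M" "exp_tail (\<lambda>n. \<P>(\<omega> in M. E n \<omega>))"
  shows "exp_unlikely M E"
  using assms by (simp add: exp_unlikely_def)

lemma (in finite_measure) exp_unlikely_disj:
  assumes "exp_unlikely M E" "exp_unlikely M F"
  shows "exp_unlikely M (\<lambda>n \<omega>. E n \<omega> \<or> F n \<omega>)"
proof (rule exp_unlikelyI)
  have E: "{\<omega> \<in> space M. E n \<omega>} \<in> sets M" and F: "{\<omega> \<in> space M. F n \<omega>} \<in> sets M" if "1 \<le> n" for n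
    using assms that by (auto simp: exp_unlikely_def)
  have split: "{\<omega> \<in> space M. E n \<omega> \<or> F n \<omega>} = {\<omega> \<in> space M. E n \<omega>} \<union> {\<omega> \<in> space M. F n \<omega>}" for n
    by auto
  show "{\<omega> \<in> space M. E n \<omega> \<or> F n \<omega>} \<in> sets M" if "1 \<le> n" for n
    unfolding split using E F that by simp
  show "exp_tail (\<lambda>n. \<P>(\<omega> in M. E n \<omega> \<or> F n \<omega>))"
  proof (rule exp_tail_add)
    show "exp_tail (\<lambda>n. \<P>(\<omega> in M. E n \<omega>))" "exp_tail (\<lambda>n. \<P>(\<omega> in M. F n \<omega>))"
      using assms by (auto simp: exp_unlikely_def)
  qed (simp only: split measure_Un_le E F)
qed

text \<open>Monotonicity of \<^const>\<open>measure\<close> asks the larger event to be measurable. An exponential tail thus passes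
from \<open>F\<close> to an event about whose measurability nothing is known.\<close>

lemma (in finite_measure) exp_tail_of_unlikely:
  assumes "exp_unlikely M F" "\<And>n. 1 \<le> n \<Longrightarrow> AE \<omega> in M. E n \<omega> \<longrightarrow> F n \<omega>"
  shows "exp_tail (\<lambda>n. \<P>(\<omega> in M. E n \<omega>))"
proof (rule exp_tail_mono)
  show "exp_tail (\<lambda>n. \<P>(\<omega> in M. F n \<omega>))"
    using assms(1) by (simp add: exp_unlikely_def)
  fix n :: nat assume n: "1 \<le> n"
  have "AE \<omega> in M. \<omega> \<in> {\<omega> \<in> space M. E n \<omega>} \<longrightarrow> \<omega> \<in> {\<omega> \<in> space M. F n \<omega>}"
    using assms(2)[OF n] by eventually_elim simp
  then show "\<P>(\<omega> in M. E n \<omega>) \<le> \<P>(\<omega> in M. F n \<omega>)"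
    using assms(1) n by (intro finite_measure_mono_AE) (auto simp: exp_unlikely_def)
qed

section \<open>The error of the empirical-residuals objective\<close>

abbreviation (input) avg :: "nat \<Rightarrow> (nat \<Rightarrow> real) \<Rightarrow> real" where
  "avg n u \<equiv> (1 / real n) * (\<Sum>i=1..n. u i)"

lemma avg_mono: "(\<And>i. i \<in> {1..n} \<Longrightarrow> u i \<le> v i) \<Longrightarrow> avg n u \<le> avg n v"
  by (intro mult_left_mono sum_mono) auto

lemma avg_nonneg: "(\<And>i. i \<in> {1..n} \<Longrightarrow> 0 \<le> u i) \<Longrightarrow> 0 \<le> avg n u"
  by (intro mult_nonneg_nonneg sum_nonneg) auto

lemma avg_add: "avg n (\<lambda>i. u i + v i) = avg n u + avg n v"
  by (simp add: sum.distrib distrib_left)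

lemma avg_const_mult: "avg n (\<lambda>i. r * u i) = r * avg n u"
  by (simp add: sum_distrib_left mult.left_commute)

lemma avg_mult_le_sqrt:
  "avg n (\<lambda>i. u i * v i) \<le> sqrt (avg n (\<lambda>i. (u i)\<^sup>2)) * sqrt (avg n (\<lambda>i. (v i)\<^sup>2))"
proof -
  have "(avg n (\<lambda>i. u i * v i))\<^sup>2 = (1 / real n)\<^sup>2 * (\<Sum>i=1..n. u i * v i)\<^sup>2"
    by (simp only: power_mult_distrib)
  also have "\<dots> \<le> (1 / real n)\<^sup>2 * ((\<Sum>i=1..n. (u i)\<^sup>2) * (\<Sum>i=1..n. (v i)\<^sup>2))"
    by (intro mult_left_mono Cauchy_Schwarz_ineq_sum) simp
  also have "\<dots> = avg n (\<lambda>i. (u i)\<^sup>2) * avg n (\<lambda>i. (v i)\<^sup>2)"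
    by (simp add: power2_eq_square)
  finally have "avg n (\<lambda>i. u i * v i) \<le> sqrt (avg n (\<lambda>i. (u i)\<^sup>2) * avg n (\<lambda>i. (v i)\<^sup>2))"
    by (rule real_le_rsqrt)
  then show ?thesis
    by (simp only: real_sqrt_mult)
qed

lemma root_4_eq_sqrt_sqrt: "root 4 x = sqrt (sqrt x)"
  using real_root_mult_exp[of 2 2 x] by (simp add: sqrt_def)

text \<open>Cauchy-Schwarz twice, giving the Hoelder inequality with exponents \<open>2\<close>, \<open>4\<close>, \<open>4\<close>. These exponents are the
reason why fourth moments of \<open>Q\<close> and of the errors occur next to second moments of the inverses.\<close>

lemma avg_mult_mult_le_roots:
  "avg n (\<lambda>i. a i * (q i * e i)) \<le>
     sqrt (avg n (\<lambda>i. (a i)\<^sup>2)) * (root 4 (avg n (\<lambda>i. q i ^ 4)) * root 4 (avg n (\<lambda>i. e i ^ 4)))"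
proof -
  have "avg n (\<lambda>i. (q i * e i)\<^sup>2) \<le> sqrt (avg n (\<lambda>i. q i ^ 4)) * sqrt (avg n (\<lambda>i. e i ^ 4))"
    using avg_mult_le_sqrt[of n "\<lambda>i. (q i)\<^sup>2" "\<lambda>i. (e i)\<^sup>2"] by (simp add: power_mult_distrib)
  then have "sqrt (avg n (\<lambda>i. (q i * e i)\<^sup>2)) \<le>
      root 4 (avg n (\<lambda>i. q i ^ 4)) * root 4 (avg n (\<lambda>i. e i ^ 4))"
    unfolding root_4_eq_sqrt_sqrt real_sqrt_mult[symmetric] by (simp only: real_sqrt_le_iff)
  moreover have "0 \<le> sqrt (avg n (\<lambda>i. (a i)\<^sup>2))"
    by (intro real_sqrt_ge_zero avg_nonneg) simp
  ultimately show ?thesis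
    using avg_mult_le_sqrt[of n a "\<lambda>i. q i * e i"] by (meson mult_left_mono order_trans)
qed

text \<open>With \<open>y - f x = Q x e\<close>, where \<open>e\<close> is the true residual, the difference of the residuals is
\<open>(Qh x\<^sup>-\<^sup>1 - Q x\<^sup>-\<^sup>1) Q x e + Qh x\<^sup>-\<^sup>1 (f x - fh x)\<close>. The inverse of the estimate \<open>Qh x\<close> in the second term is not
controlled by itself, so it is compared with the inverse of \<open>Q x\<close>.\<close>

lemma residual_error:
  assumes "invertible (Q x)"
  shows "norm (residual fh Qh y x - residual f Q y x) \<le>
    op_norm (matrix_inv (Qh x) - matrix_inv (Q x)) * (op_norm (Q x) * norm (residual f Q y x)) +
    (op_norm (matrix_inv (Qh x) - matrix_inv (Q x)) + op_norm (matrix_inv (Q x))) * norm (f x - fh x)"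
proof -
  let ?V = "matrix_inv (Q x)" and ?W = "matrix_inv (Qh x)" and ?u = "y - f x" and ?r = "f x - fh x"
  let ?e = "residual f Q y x"
  have u: "?u = Q x *v ?e"
    by (simp add: residual_def matrix_vector_mul_assoc matrix_inv_works[OF assms])
  have "y - fh x = ?u + ?r"
    by simp
  then have "residual fh Qh y x - ?e = ?W *v ?u + ?W *v ?r - ?V *v ?u"
    unfolding residual_def by (simp only: matrix_vector_right_distrib)
  also have "\<dots> = (?W - ?V) *v ?u + ?W *v ?r"
    by (simp only: matrix_vector_mult_diff_rdistrib) simp
  finally have "norm (residual fh Qh y x - ?e) \<le> norm ((?W - ?V) *v ?u) + norm (?W *v ?r)"
    by (metis norm_triangle_ineq)
  also have "\<dots> \<le> op_norm (?W - ?V) * norm ?u + op_norm ?W * norm ?r"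
    by (intro add_mono op_norm_bound)
  also have "\<dots> \<le> op_norm (?W - ?V) * (op_norm (Q x) * norm ?e) + (op_norm (?W - ?V) + op_norm ?V) * norm ?r"
    by (subst u) (intro add_mono mult_left_mono mult_right_mono op_norm_bound op_norm_nonneg
        op_norm_le_add_diff norm_ge_zero)
  finally show ?thesis .
qed

text \<open>The true scenario lies in \<open>Y\<close>, so the projection fixes it, and since projections onto convex sets are
nonexpansive, projecting the estimated scenario brings it no further from the true one.\<close>

lemma projected_scenario_error:
  assumes "closed Y" "convex Y" "f + Q *v e \<in> Y"
  shows "norm (closest_point Y (fh + Qh *v e') - (f + Q *v e)) \<le>
    norm (f - fh) + op_norm (Q - Qh) * (norm e + norm (e' - e)) + op_norm Q * norm (e' - e)"
proof -
  have "norm (closest_point Y (fh + Qh *v e') - closest_point Y (f + Q *v e)) \<le>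
      norm ((fh + Qh *v e') - (f + Q *v e))"
    using closest_point_lipschitz[OF assms(2,1), of "fh + Qh *v e'" "f + Q *v e"] assms(3)
    unfolding dist_norm by blast
  also have "(fh + Qh *v e') - (f + Q *v e) = (fh - f) + ((Qh - Q) *v e' + Q *v (e' - e))"
    by (simp add: matrix_vector_mult_diff_rdistrib matrix_vector_mult_diff_distrib)
  also have "norm \<dots> \<le> norm (fh - f) + (norm ((Qh - Q) *v e') + norm (Q *v (e' - e)))"
    by (meson add_left_mono norm_triangle_ineq order_trans)
  also have "\<dots> \<le> norm (fh - f) + (op_norm (Qh - Q) * norm e' + op_norm Q * norm (e' - e))"
    by (intro add_mono op_norm_bound order_refl)
  also have "\<dots> \<le> norm (fh - f) + (op_norm (Qh - Q) * (norm e + norm (e' - e)) + op_norm Q * norm (e' - e))"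
    by (intro add_mono mult_left_mono op_norm_nonneg norm_triangle_sub order_refl)
  finally show ?thesis
    by (simp add: closest_point_self[OF assms(3)] norm_minus_commute[of fh] op_norm_minus_commute[of Qh])
qed

lemma avg_residual_error:
  assumes "\<And>i. i \<in> {1..n} \<Longrightarrow> invertible (Q (xi i))"
  shows "avg n (\<lambda>i. norm (residual fh Qh (yi i) (xi i) - residual f Q (yi i) (xi i))) \<le>
    sqrt (avg n (\<lambda>i. (op_norm (matrix_inv (Qh (xi i)) - matrix_inv (Q (xi i))))\<^sup>2)) *
      (root 4 (avg n (\<lambda>i. op_norm (Q (xi i)) ^ 4)) *
       root 4 (avg n (\<lambda>i. norm (residual f Q (yi i) (xi i)) ^ 4))) +
    (sqrt (avg n (\<lambda>i. (op_norm (matrix_inv (Qh (xi i)) - matrix_inv (Q (xi i))))\<^sup>2)) +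
      sqrt (avg n (\<lambda>i. (op_norm (matrix_inv (Q (xi i))))\<^sup>2))) *
      sqrt (avg n (\<lambda>i. (norm (f (xi i) - fh (xi i)))\<^sup>2))"
proof -
  define a where "a i = op_norm (matrix_inv (Qh (xi i)) - matrix_inv (Q (xi i)))" for i
  define b where "b i = op_norm (matrix_inv (Q (xi i)))" for i
  define q where "q i = op_norm (Q (xi i))" for i
  define e where "e i = norm (residual f Q (yi i) (xi i))" for i
  define r where "r i = norm (f (xi i) - fh (xi i))" for i
  \<comment> \<open>Expanding \<open>(a + b) r\<close> lets Cauchy-Schwarz treat \<open>a r\<close> and \<open>b r\<close> separately.\<close>
  have "avg n (\<lambda>i. norm (residual fh Qh (yi i) (xi i) - residual f Q (yi i) (xi i))) \<le>
      avg n (\<lambda>i. a i * (q i * e i) + (a i * r i + b i * r i))"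
  proof (rule avg_mono)
    fix i assume "i \<in> {1..n}"
    then show "norm (residual fh Qh (yi i) (xi i) - residual f Q (yi i) (xi i)) \<le>
        a i * (q i * e i) + (a i * r i + b i * r i)"
      using residual_error[of Q "xi i" fh Qh "yi i" f] assms
      by (simp add: a_def b_def q_def e_def r_def distrib_right)
  qed
  also have "\<dots> = avg n (\<lambda>i. a i * (q i * e i)) + (avg n (\<lambda>i. a i * r i) + avg n (\<lambda>i. b i * r i))"
    by (simp only: avg_add)
  also have "\<dots> \<le> sqrt (avg n (\<lambda>i. (a i)\<^sup>2)) * (root 4 (avg n (\<lambda>i. q i ^ 4)) * root 4 (avg n (\<lambda>i. e i ^ 4))) +
      (sqrt (avg n (\<lambda>i. (a i)\<^sup>2)) * sqrt (avg n (\<lambda>i. (r i)\<^sup>2)) +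
       sqrt (avg n (\<lambda>i. (b i)\<^sup>2)) * sqrt (avg n (\<lambda>i. (r i)\<^sup>2)))"
    by (intro add_mono avg_mult_mult_le_roots avg_mult_le_sqrt)
  also have "\<dots> = sqrt (avg n (\<lambda>i. (a i)\<^sup>2)) * (root 4 (avg n (\<lambda>i. q i ^ 4)) * root 4 (avg n (\<lambda>i. e i ^ 4))) +
      (sqrt (avg n (\<lambda>i. (a i)\<^sup>2)) + sqrt (avg n (\<lambda>i. (b i)\<^sup>2))) * sqrt (avg n (\<lambda>i. (r i)\<^sup>2))"
    by (simp only: distrib_right)
  finally show ?thesis
    unfolding a_def b_def q_def e_def r_def .
qed

lemma er_saa_obj_error:
  assumes Y: "closed Y" "convex Y"
    and lip: "\<And>y y'. y \<in> Y \<Longrightarrow> y' \<in> Y \<Longrightarrow> \<bar>c z y' - c z y\<bar> \<le> l * norm (y' - y)" and l: "0 \<le> l"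
    and scen: "\<And>i. i \<in> {1..n} \<Longrightarrow> f x + Q x *v residual f Q (fst (d i)) (snd (d i)) \<in> Y"
    and n: "1 \<le> n"
    and D: "avg n (\<lambda>i. norm (residual fh Qh (fst (d i)) (snd (d i)) - residual f Q (fst (d i)) (snd (d i)))) \<le> D"
    and E: "avg n (\<lambda>i. norm (residual f Q (fst (d i)) (snd (d i)))) \<le> E"
  shows "\<bar>er_saa_obj c Y fh Qh n d z x - saa_obj c f Q n d z x\<bar> \<le>
    l * (norm (f x - fh x) + op_norm (Q x - Qh x) * (E + D) + op_norm (Q x) * D)"
proof -
  define e where "e i = residual f Q (fst (d i)) (snd (d i))" for i
  define e' where "e' i = residual fh Qh (fst (d i)) (snd (d i))" for i
  define p where "p i = closest_point Y (fh x + Qh x *v e' i)" for i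
  define s where "s i = f x + Q x *v e i" for i
  have s: "s i \<in> Y" if "i \<in> {1..n}" for i
    using scen[OF that] by (simp add: s_def e_def)
  have p: "p i \<in> Y" for i
    unfolding p_def using scen[of 1] n by (intro closest_point_in_set Y) auto
  have "er_saa_obj c Y fh Qh n d z x - saa_obj c f Q n d z x = avg n (\<lambda>i. c z (p i) - c z (s i))"
    by (simp add: er_saa_obj_def saa_obj_def p_def s_def e_def e'_def sum_subtractf right_diff_distrib)
  then have "\<bar>er_saa_obj c Y fh Qh n d z x - saa_obj c f Q n d z x\<bar> =
      (1 / real n) * \<bar>\<Sum>i=1..n. c z (p i) - c z (s i)\<bar>"
    by (simp add: abs_mult)
  also have "\<dots> \<le> avg n (\<lambda>i. \<bar>c z (p i) - c z (s i)\<bar>)"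
    by (intro mult_left_mono sum_abs) simp
  also have "\<dots> \<le> avg n (\<lambda>i. l * (norm (f x - fh x) + op_norm (Q x - Qh x) * (norm (e i) + norm (e' i - e i)) +
      op_norm (Q x) * norm (e' i - e i)))"
  proof (rule avg_mono)
    fix i assume i: "i \<in> {1..n}"
    have "\<bar>c z (p i) - c z (s i)\<bar> \<le> l * norm (p i - s i)"
      by (intro lip s p i)
    also have "\<dots> \<le> l * (norm (f x - fh x) + op_norm (Q x - Qh x) * (norm (e i) + norm (e' i - e i)) +
        op_norm (Q x) * norm (e' i - e i))"
      unfolding p_def s_def
      by (intro mult_left_mono l projected_scenario_error Y s[OF i, unfolded s_def])
    finally show "\<bar>c z (p i) - c z (s i)\<bar> \<le> \<dots>" .
  qed
  also have "\<dots> = l * (avg n (\<lambda>i. norm (f x - fh x)) +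
      op_norm (Q x - Qh x) * (avg n (\<lambda>i. norm (e i)) + avg n (\<lambda>i. norm (e' i - e i))) +
      op_norm (Q x) * avg n (\<lambda>i. norm (e' i - e i)))"
    by (simp only: avg_const_mult avg_add)
  also have "\<dots> \<le> l * (norm (f x - fh x) + op_norm (Q x - Qh x) * (E + D) + op_norm (Q x) * D)"
    using n D E unfolding e_def e'_def
    by (intro mult_left_mono add_mono l op_norm_nonneg) simp_all
  finally show ?thesis .
qed

text \<open>The bound is of the form \<open>\<tau> W\<close>, where \<open>\<tau>\<close> bounds all estimation errors and \<open>W\<close> involves the
sample only through the bounds on its moments, which can be chosen once for all \<open>n\<close>. The assumption \<open>\<tau> \<le> 1\<close> serves to replace the terms quadratic in \<open>\<tau>\<close> by linear ones.\<close>

lemma er_saa_obj_error_uniform: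
  assumes Y: "closed Y" "convex Y"
    and lip: "\<And>y y'. y \<in> Y \<Longrightarrow> y' \<in> Y \<Longrightarrow> \<bar>c z y' - c z y\<bar> \<le> l * norm (y' - y)" and l: "0 \<le> l"
    and scen: "\<And>i. i \<in> {1..n} \<Longrightarrow> f x + Q x *v residual f Q (fst (d i)) (snd (d i)) \<in> Y"
    and inv: "\<And>i. i \<in> {1..n} \<Longrightarrow> invertible (Q (snd (d i)))"
    and n: "1 \<le> n"
    and \<tau>: "0 \<le> \<tau>" "\<tau> \<le> 1"
    and B: "sqrt (avg n (\<lambda>i. (op_norm (matrix_inv (Q (snd (d i)))))\<^sup>2)) \<le> B"
    and C: "root 4 (avg n (\<lambda>i. op_norm (Q (snd (d i))) ^ 4)) \<le> C"
    and E1: "avg n (\<lambda>i. norm (residual f Q (fst (d i)) (snd (d i)))) \<le> E1"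
    and E4: "root 4 (avg n (\<lambda>i. norm (residual f Q (fst (d i)) (snd (d i))) ^ 4)) \<le> E4"
    and fx: "norm (f x - fh x) \<le> \<tau>"
    and fd: "avg n (\<lambda>i. (norm (f (snd (d i)) - fh (snd (d i))))\<^sup>2) \<le> \<tau>\<^sup>2"
    and Qx: "op_norm (Q x - Qh x) \<le> \<tau>"
    and Qd: "avg n (\<lambda>i. (op_norm (matrix_inv (Qh (snd (d i))) - matrix_inv (Q (snd (d i)))))\<^sup>2) \<le> \<tau>\<^sup>2"
  shows "\<bar>er_saa_obj c Y fh Qh n d z x - saa_obj c f Q n d z x\<bar> \<le>
    \<tau> * (l * (1 + (E1 + (C * E4 + (1 + B))) + op_norm (Q x) * (C * E4 + (1 + B))))"
proof -
  let ?a = "sqrt (avg n (\<lambda>i. (op_norm (matrix_inv (Qh (snd (d i))) - matrix_inv (Q (snd (d i)))))\<^sup>2))"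
  let ?b = "sqrt (avg n (\<lambda>i. (op_norm (matrix_inv (Q (snd (d i)))))\<^sup>2))"
  let ?q = "root 4 (avg n (\<lambda>i. op_norm (Q (snd (d i))) ^ 4))"
  let ?e = "root 4 (avg n (\<lambda>i. norm (residual f Q (fst (d i)) (snd (d i))) ^ 4))"
  let ?r = "sqrt (avg n (\<lambda>i. (norm (f (snd (d i)) - fh (snd (d i))))\<^sup>2))"
  define D where "D = \<tau> * (C * E4 + (1 + B))"
  have a: "?a \<le> \<tau>" and r: "?r \<le> \<tau>"
    using Qd fd \<tau> by (auto intro: real_le_lsqrt)
  have nonneg: "0 \<le> ?a" "0 \<le> ?b" "0 \<le> ?q" "0 \<le> ?e" "0 \<le> ?r"
    by (intro real_sqrt_ge_zero real_root_ge_zero avg_nonneg; simp)+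
  have BCE: "0 \<le> B" "0 \<le> C" "0 \<le> E4"
    using nonneg B C E4 by linarith+
  have "0 \<le> avg n (\<lambda>i. norm (residual f Q (fst (d i)) (snd (d i))))"
    by (intro avg_nonneg) simp
  with E1 have "0 \<le> E1"
    by linarith
  have "?a * (?q * ?e) \<le> \<tau> * (C * E4)" "(?a + ?b) * ?r \<le> (1 + B) * \<tau>"
    using a r \<tau> B C E4 nonneg BCE by (intro mult_mono mult_nonneg_nonneg add_nonneg_nonneg add_mono; linarith)+
  then have D: "avg n (\<lambda>i. norm (residual fh Qh (fst (d i)) (snd (d i)) - residual f Q (fst (d i)) (snd (d i)))) \<le> D"
    using avg_residual_error[of n Q "\<lambda>i. snd (d i)" fh Qh "\<lambda>i. fst (d i)" f, OF inv]
    unfolding D_def by (simp add: distrib_left mult.commute)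
  have "0 \<le> D"
    using \<tau> BCE by (simp add: D_def)
  have "D \<le> C * E4 + (1 + B)"
    using \<tau> BCE mult_right_mono[of \<tau> 1 "C * E4 + (1 + B)"] by (simp add: D_def)
  then have "op_norm (Q x - Qh x) * (E1 + D) \<le> \<tau> * (E1 + (C * E4 + (1 + B)))"
    using Qx \<tau> \<open>0 \<le> D\<close> \<open>0 \<le> E1\<close> by (intro mult_mono) auto
  then have "norm (f x - fh x) + op_norm (Q x - Qh x) * (E1 + D) + op_norm (Q x) * D \<le>
      \<tau> + \<tau> * (E1 + (C * E4 + (1 + B))) + op_norm (Q x) * D"
    using fx by linarith
  also have "\<dots> = \<tau> * (1 + (E1 + (C * E4 + (1 + B))) + op_norm (Q x) * (C * E4 + (1 + B)))"
    unfolding D_def by (simp add: algebra_simps)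
  finally have "l * (norm (f x - fh x) + op_norm (Q x - Qh x) * (E1 + D) + op_norm (Q x) * D) \<le>
      \<tau> * (l * (1 + (E1 + (C * E4 + (1 + B))) + op_norm (Q x) * (C * E4 + (1 + B))))"
    using l by (simp only: mult.left_commute[of \<tau> l]) (rule mult_left_mono)
  with er_saa_obj_error[where c = c and z = z and d = d, OF Y lip l scen n D E1] show ?thesis
    by linarith
qed

section \<open>Measurability of the data-driven quantities\<close>

lemma borel_measurable_matrix_vector_mult:
  fixes A :: "'w \<Rightarrow> real^'n^'m"
  assumes "A \<in> borel_measurable M" "v \<in> borel_measurable M"
  shows "(\<lambda>\<omega>. A \<omega> *v v \<omega>) \<in> borel_measurable M"
  using assms unfolding matrix_vector_mult_def
  by (rule borel_measurable_continuous_Pair) (intro continuous_intros)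

context er_saa
begin

text \<open>The complement of a support is the union of the open null sets.\<close>

lemma closed_Y: "closed \<Y>"
proof -
  have "- \<Y> = \<Union> {U. open U \<and> emeasure (distr N borel Y) U = 0}"
    unfolding Y_support topological_support_def by (auto simp: zero_less_iff_neq_zero)
  then show ?thesis
    unfolding closed_def by auto
qed

lemma sample_measurable:
  "sample ys xs n \<in> measurable M (\<Pi>\<^sub>M i\<in>{1..n}. borel)"
  unfolding sample_def by (intro measurable_restrict borel_measurable_Pair xs_measurable ys_measurable) auto

text \<open>The estimate is evaluated at a random point, as in the in-sample errors, where the point is itself
part of the sample. Joint measurability in the data set and the point is what this needs.\<close>

lemma estimate_measurable:
  assumes "(\<lambda>(d, x). E d x) \<in> borel_measurable ((\<Pi>\<^sub>M i\<in>{1..n}. borel) \<Otimes>\<^sub>M borel)"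
    and "g \<in> borel_measurable M"
  shows "(\<lambda>\<omega>. E (sample ys xs n \<omega>) (g \<omega>)) \<in> borel_measurable M"
  using measurable_compose[OF measurable_Pair[OF sample_measurable assms(2)] assms(1)] by simp

lemma residual_measurable:
  assumes "1 \<le> i"
  shows "(\<lambda>\<omega>. residual fs Qs (ys i \<omega>) (xs i \<omega>)) \<in> borel_measurable M"
  unfolding residual_def
  using assms xs_measurable ys_measurable fs_measurable Qs_measurable
  by (intro borel_measurable_matrix_vector_mult borel_measurable_diff
      measurable_compose[OF _ matrix_inv_measurable] measurable_compose[OF _ Qs_measurable]
      measurable_compose[OF _ fs_measurable])

end

section \<open>Exponential convergence of the estimated solutions\<close>

theorem theorem8:
  fixes N :: "'a measure" and M :: "'w measure"
    and X :: "'a \<Rightarrow> real^'x::finite" and Y :: "'a \<Rightarrow> real^'y::finite" and \<epsilon> :: "'a \<Rightarrow> real^'y"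
    and P\<^sub>X :: "(real^'x) measure" and P\<^sub>\<epsilon> :: "(real^'y) measure"
    and \<X> :: "(real^'x) set" and \<Y> :: "(real^'y) set" and \<Z> :: "(real^'z::finite) set"
    and c :: "real^'z \<Rightarrow> real^'y \<Rightarrow> real" and L :: "real^'z \<Rightarrow> real"
    and fs :: "real^'x \<Rightarrow> real^'y" and Qs :: "real^'x \<Rightarrow> real^'y^'y"
    and ys :: "nat \<Rightarrow> 'w \<Rightarrow> real^'y" and xs :: "nat \<Rightarrow> 'w \<Rightarrow> real^'x"
    and fh :: "nat \<Rightarrow> ('y, 'x) dataset \<Rightarrow> real^'x \<Rightarrow> real^'y"
    and Qh :: "nat \<Rightarrow> ('y, 'x) dataset \<Rightarrow> real^'x \<Rightarrow> real^'y^'y"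
    and zh :: "nat \<Rightarrow> 'w \<Rightarrow> real^'x \<Rightarrow> real^'z"
  assumes setting: "er_saa N M X Y \<epsilon> P\<^sub>X P\<^sub>\<epsilon> \<X> \<Y> \<Z> c fs Qs ys xs fh Qh zh"
    \<comment> \<open>(1)\<close>
    and lipschitz: "\<And>z y y'. z \<in> \<Z> \<Longrightarrow> y \<in> \<Y> \<Longrightarrow> y' \<in> \<Y> \<Longrightarrow>
          \<bar>c z y' - c z y\<bar> \<le> L z * norm (y' - y)"
    and L_bounded: "bdd_above (L ` \<Z>)"
    \<comment> \<open>(2)\<close>
    and uniform_saa: "\<And>\<kappa>::real. \<kappa> > 0 \<Longrightarrow> AE x\<in>\<X> in P\<^sub>X. \<exists>K>0. \<exists>\<beta>>0. \<forall>n\<ge>1.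
          \<P>(\<omega> in M. (SUP z\<in>\<Z>. ereal \<bar>saa_obj c fs Qs n (sample ys xs n \<omega>) z x
                                    - true_obj c P\<^sub>\<epsilon> fs Qs z x\<bar>) > ereal \<kappa>)
            \<le> K * exp (- (real n * \<beta>))"
    \<comment> \<open>(3)\<close>
    and Qs_inv_moment: "integrable N (\<lambda>a. (op_norm (matrix_inv (Qs (X a))))^2)"
    and Qs_moment: "integrable N (\<lambda>a. (op_norm (Qs (X a)))^4)"
    and Qs_inv_tail: "\<And>\<kappa>::real. \<kappa> > 0 \<Longrightarrow> exp_tail (\<lambda>n.
          \<P>(\<omega> in M. sqrt ((1 / real n) * (\<Sum>i=1..n. (op_norm (matrix_inv (Qs (xs i \<omega>))))^2))
                    > sqrt (\<integral>a. (op_norm (matrix_inv (Qs (X a))))^2 \<partial>N) + \<kappa>))"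
    and Qs_tail: "\<And>\<kappa>::real. \<kappa> > 0 \<Longrightarrow> exp_tail (\<lambda>n.
          \<P>(\<omega> in M. root 4 ((1 / real n) * (\<Sum>i=1..n. (op_norm (Qs (xs i \<omega>)))^4))
                    > root 4 (\<integral>a. (op_norm (Qs (X a)))^4 \<partial>N) + \<kappa>))"
    \<comment> \<open>(4)\<close>
    and eps_moment: "integrable N (\<lambda>a. norm (\<epsilon> a)^4)"
    and eps_tail1: "\<And>\<kappa>::real. \<kappa> > 0 \<Longrightarrow> exp_tail (\<lambda>n.
          \<P>(\<omega> in M. (1 / real n) * (\<Sum>i=1..n. norm (residual fs Qs (ys i \<omega>) (xs i \<omega>)))
                    > (\<integral>a. norm (\<epsilon> a) \<partial>N) + \<kappa>))"
    and eps_tail4: "\<And>\<kappa>::real. \<kappa> > 0 \<Longrightarrow> exp_tail (\<lambda>n.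
          \<P>(\<omega> in M. root 4 ((1 / real n) * (\<Sum>i=1..n. norm (residual fs Qs (ys i \<omega>) (xs i \<omega>))^4))
                    > root 4 (\<integral>a. norm (\<epsilon> a)^4 \<partial>N) + \<kappa>))"
    \<comment> \<open>(5)\<close>
    and fh_pointwise: "\<And>\<kappa>::real. \<kappa> > 0 \<Longrightarrow> AE x\<in>\<X> in P\<^sub>X. exp_tail (\<lambda>n.
          \<P>(\<omega> in M. norm (fs x - fh n (sample ys xs n \<omega>) x) > \<kappa>))"
    and fh_mean_square: "\<And>\<kappa>::real. \<kappa> > 0 \<Longrightarrow> exp_tail (\<lambda>n.
          \<P>(\<omega> in M. (1 / real n) *
              (\<Sum>i=1..n. norm (fs (xs i \<omega>) - fh n (sample ys xs n \<omega>) (xs i \<omega>))^2) > \<kappa>^2))"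
    and Qh_pointwise: "\<And>\<kappa>::real. \<kappa> > 0 \<Longrightarrow> AE x\<in>\<X> in P\<^sub>X. exp_tail (\<lambda>n.
          \<P>(\<omega> in M. op_norm (Qs x - Qh n (sample ys xs n \<omega>) x) > \<kappa>))"
    and Qh_inv_mean_square: "\<And>\<kappa>::real. \<kappa> > 0 \<Longrightarrow> exp_tail (\<lambda>n.
          \<P>(\<omega> in M. (1 / real n) *
              (\<Sum>i=1..n. (op_norm (matrix_inv (Qh n (sample ys xs n \<omega>) (xs i \<omega>))
                                   - matrix_inv (Qs (xs i \<omega>))))^2) > \<kappa>^2))"
  shows "AE x\<in>\<X> in P\<^sub>X. \<forall>\<eta>>0. \<exists>K>0. \<exists>\<gamma>::nat \<Rightarrow> real.
           (\<forall>n\<ge>1. 0 < \<gamma> n) \<and> filterlim \<gamma> at_top sequentially \<and>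
           (\<forall>n\<ge>1. \<P>(\<omega> in M. infdist (zh n \<omega> x) (argmin_set \<Z> (\<lambda>z. true_obj c P\<^sub>\<epsilon> fs Qs z x)) \<ge> \<eta>)
                     \<le> K * exp (- \<gamma> n))"
proof -
  interpret er_saa N M X Y \<epsilon> P\<^sub>X P\<^sub>\<epsilon> \<X> \<Y> \<Z> c fs Qs ys xs fh Qh zh
    by (rule setting)
  \<comment> \<open>The hypotheses hold outside a null set of covariates that may depend on the level \<open>\<kappa>\<close>. Along a
    sequence of levels that tends to \<open>0\<close> the exceptional sets can be united.\<close>
  define \<theta> where "\<theta> k = 1 / real (Suc k)" for k
  have \<theta>: "0 < \<theta> k" "\<theta> k \<le> 1" for k
    by (simp_all add: \<theta>_def)
  define l where "l = max 0 (SUP z\<in>\<Z>. L z)"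
  have l: "0 \<le> l" "\<And>z. z \<in> \<Z> \<Longrightarrow> L z \<le> l"
    using cSUP_upper[OF _ L_bounded] by (auto simp: l_def le_max_iff_disj)
  have lip: "\<bar>c z y' - c z y\<bar> \<le> l * norm (y' - y)" if "z \<in> \<Z>" "y \<in> \<Y>" "y' \<in> \<Y>" for z y y'
    using lipschitz[OF that] mult_right_mono[OF l(2)[OF that(1)], of "norm (y' - y)"] by simp

  define dev where "dev n \<omega> x = (SUP z\<in>\<Z>. ereal \<bar>saa_obj c fs Qs n (sample ys xs n \<omega>) z x
      - true_obj c P\<^sub>\<epsilon> fs Qs z x\<bar>)" for n \<omega> x
  have AE_levels: "AE x in P\<^sub>X. \<forall>k. x \<in> \<X> \<longrightarrow> P (\<theta> k) x"
    if "\<And>\<kappa>. 0 < \<kappa> \<Longrightarrow> AE x\<in>\<X> in P\<^sub>X. P \<kappa> x" for P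
    unfolding AE_all_countable using that \<theta>(1) by blast
  have AE_sizes: "AE x in P\<^sub>X. \<forall>n. 1 \<le> n \<longrightarrow> x \<in> \<X> \<longrightarrow> P n x"
    if "\<And>n. 1 \<le> n \<Longrightarrow> AE x\<in>\<X> in P\<^sub>X. P n x" for P :: "nat \<Rightarrow> _"
    unfolding AE_all_countable using that by (auto intro!: AE_impI)
  have data_in: "AE \<omega> in M. \<forall>i. 1 \<le> i \<longrightarrow> xs i \<omega> \<in> \<X>"
    unfolding AE_all_countable using xs_in by (auto intro!: AE_impI)

  have AE_scen: "AE x in P\<^sub>X. \<forall>i. 1 \<le> i \<longrightarrow> x \<in> \<X> \<longrightarrow>
        (AE \<omega> in M. fs x + Qs x *v residual fs Qs (ys i \<omega>) (xs i \<omega>) \<in> \<Y>)"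
    by (rule AE_sizes, rule scenario_in)
  have AE_meas: "AE x in P\<^sub>X. \<forall>n. 1 \<le> n \<longrightarrow> x \<in> \<X> \<longrightarrow>
        (\<lambda>\<omega>. SUP z\<in>\<Z>. ereal \<bar>saa_obj c fs Qs n (sample ys xs n \<omega>) z x
                                - true_obj c P\<^sub>\<epsilon> fs Qs z x\<bar>) \<in> borel_measurable M"
    by (rule AE_sizes, rule sup_measurable)
  have AE_opt: "AE x in P\<^sub>X. \<forall>n. 1 \<le> n \<longrightarrow> x \<in> \<X> \<longrightarrow> (AE \<omega> in M.
          zh n \<omega> x \<in> argmin_set \<Z> (\<lambda>z. er_saa_obj c \<Y> (fh n (sample ys xs n \<omega>))
            (Qh n (sample ys xs n \<omega>)) n (sample ys xs n \<omega>) z x))"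
    by (rule AE_sizes, rule zh_optimal)
  have AE_lsc: "AE x in P\<^sub>X. x \<in> \<X> \<longrightarrow> lsc_on \<Z> (\<lambda>z. true_obj c P\<^sub>\<epsilon> fs Qs z x)"
    by (rule g_lsc)
  have AE_saa: "AE x in P\<^sub>X. \<forall>k. x \<in> \<X> \<longrightarrow> (\<exists>K>0. \<exists>\<beta>>0. \<forall>n\<ge>1.
          \<P>(\<omega> in M. (SUP z\<in>\<Z>. ereal \<bar>saa_obj c fs Qs n (sample ys xs n \<omega>) z x
                                    - true_obj c P\<^sub>\<epsilon> fs Qs z x\<bar>) > ereal (\<theta> k))
            \<le> K * exp (- (real n * \<beta>)))"
    by (rule AE_levels, rule uniform_saa)
  have AE_fhx: "AE x in P\<^sub>X. \<forall>k. x \<in> \<X> \<longrightarrow> exp_tail (\<lambda>n. \<P>(\<omega> in M. norm (fs x - fh n (sample ys xs n \<omega>) x) > \<theta> k))"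
    by (rule AE_levels, rule fh_pointwise)
  have AE_Qhx: "AE x in P\<^sub>X. \<forall>k. x \<in> \<X> \<longrightarrow> exp_tail (\<lambda>n. \<P>(\<omega> in M. op_norm (Qs x - Qh n (sample ys xs n \<omega>) x) > \<theta> k))"
    by (rule AE_levels, rule Qh_pointwise)
  have "AE x\<in>\<X> in P\<^sub>X. \<forall>\<eta>>0. exp_tail (\<lambda>n.
      \<P>(\<omega> in M. infdist (zh n \<omega> x) (argmin_set \<Z> (\<lambda>z. true_obj c P\<^sub>\<epsilon> fs Qs z x)) \<ge> \<eta>))"
    using AE_scen AE_meas AE_opt AE_lsc AE_saa AE_fhx AE_Qhx
  proof (eventually_elim, intro impI allI)
    fix x and \<eta> :: real
    assume scen: "\<forall>i. 1 \<le> i \<longrightarrow> x \<in> \<X> \<longrightarrow>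
        (AE \<omega> in M. fs x + Qs x *v residual fs Qs (ys i \<omega>) (xs i \<omega>) \<in> \<Y>)"
      and meas: "\<forall>n. 1 \<le> n \<longrightarrow> x \<in> \<X> \<longrightarrow>
        (\<lambda>\<omega>. SUP z\<in>\<Z>. ereal \<bar>saa_obj c fs Qs n (sample ys xs n \<omega>) z x
                                - true_obj c P\<^sub>\<epsilon> fs Qs z x\<bar>) \<in> borel_measurable M"
      and opt: "\<forall>n. 1 \<le> n \<longrightarrow> x \<in> \<X> \<longrightarrow> (AE \<omega> in M.
          zh n \<omega> x \<in> argmin_set \<Z> (\<lambda>z. er_saa_obj c \<Y> (fh n (sample ys xs n \<omega>))
            (Qh n (sample ys xs n \<omega>)) n (sample ys xs n \<omega>) z x))"
      and lsc: "x \<in> \<X> \<longrightarrow> lsc_on \<Z> (\<lambda>z. true_obj c P\<^sub>\<epsilon> fs Qs z x)"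
      and saa: "\<forall>k. x \<in> \<X> \<longrightarrow> (\<exists>K>0. \<exists>\<beta>>0. \<forall>n\<ge>1.
          \<P>(\<omega> in M. (SUP z\<in>\<Z>. ereal \<bar>saa_obj c fs Qs n (sample ys xs n \<omega>) z x
                                    - true_obj c P\<^sub>\<epsilon> fs Qs z x\<bar>) > ereal (\<theta> k))
            \<le> K * exp (- (real n * \<beta>)))"
      and fhx: "\<forall>k. x \<in> \<X> \<longrightarrow> exp_tail (\<lambda>n. \<P>(\<omega> in M. norm (fs x - fh n (sample ys xs n \<omega>) x) > \<theta> k))"
      and Qhx: "\<forall>k. x \<in> \<X> \<longrightarrow> exp_tail (\<lambda>n. \<P>(\<omega> in M. op_norm (Qs x - Qh n (sample ys xs n \<omega>) x) > \<theta> k))"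
      and x: "x \<in> \<X>" and \<eta>: "0 < \<eta>"
    define g where "g z = true_obj c P\<^sub>\<epsilon> fs Qs z x" for z
    have lsc: "lsc_on \<Z> g"
      using lsc x unfolding g_def by simp
    obtain z\<^sub>0 \<kappa> where z0: "z\<^sub>0 \<in> \<Z>" and \<kappa>: "0 < \<kappa>"
      and growth: "\<And>z. z \<in> \<Z> \<Longrightarrow> \<eta> \<le> infdist z (argmin_set \<Z> g) \<Longrightarrow> g z\<^sub>0 + \<kappa> \<le> g z"
      using lsc_on_growth[OF lsc Z_compact Z_nonempty \<eta>] by blast

    \<comment> \<open>The moments are finite constants, and the tail bounds at level \<open>1\<close> let the empirical moments exceed
      them by at most \<open>1\<close> outside of exponentially unlikely events.\<close>
    define B where "B = sqrt (\<integral>a. (op_norm (matrix_inv (Qs (X a))))^2 \<partial>N) + 1"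
    define C where "C = root 4 (\<integral>a. (op_norm (Qs (X a)))^4 \<partial>N) + 1"
    define E1 where "E1 = (\<integral>a. norm (\<epsilon> a) \<partial>N) + 1"
    define E4 where "E4 = root 4 (\<integral>a. norm (\<epsilon> a)^4 \<partial>N) + 1"
    define W where "W = l * (1 + (E1 + (C * E4 + (1 + B))) + op_norm (Qs x) * (C * E4 + (1 + B)))"
    \<comment> \<open>The objectives will differ by at most \<open>\<tau> W + \<tau>\<close>. Two such differences, at the estimated solution
      and at \<open>z\<^sub>0\<close>, have to stay below the gap \<open>\<kappa>\<close>; the absolute value and the \<open>+ 1\<close> keep the divisor
      positive.\<close>
    have "0 < \<kappa> / (4 * (\<bar>W\<bar> + 1))"
      using \<kappa> by (intro divide_pos_pos) auto
    then obtain k where k: "\<theta> k < \<kappa> / (4 * (\<bar>W\<bar> + 1))"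
      unfolding \<theta>_def using nat_approx_posE by blast
    define \<tau> where "\<tau> = \<theta> k"
    have \<tau>: "0 < \<tau>" "\<tau> \<le> 1"
      by (simp_all add: \<tau>_def \<theta>)
    have "4 * (\<tau> * \<bar>W\<bar>) + 4 * \<tau> < \<kappa>"
      using k unfolding \<tau>_def[symmetric] by (simp add: pos_less_divide_eq algebra_simps)
    moreover have "\<tau> * W \<le> \<tau> * \<bar>W\<bar>" "0 \<le> \<tau> * \<bar>W\<bar>"
      using \<tau> by (intro mult_left_mono mult_nonneg_nonneg; simp)+
    ultimately have small: "2 * \<tau> + 2 * (\<tau> * W) < \<kappa>"
      using \<tau>(1) by linarith

    have sample_nth: "fst (sample ys xs n \<omega> i) = ys i \<omega>" "snd (sample ys xs n \<omega> i) = xs i \<omega>"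
      if "i \<in> {1..n}" for n i \<omega>
      using that by (simp_all add: sample_def)
    note measurable_facts =
      measurable_compose[OF _ op_norm_measurable] measurable_compose[OF _ matrix_inv_measurable]
      measurable_compose[OF xs_measurable fs_measurable] measurable_compose[OF xs_measurable Qs_measurable]
      estimate_measurable[OF fh_measurable] estimate_measurable[OF Qh_measurable]
      residual_measurable xs_measurable

    have bad_saa: "exp_unlikely M (\<lambda>n \<omega>. dev n \<omega> x > ereal \<tau>)"
    proof (rule exp_unlikelyI)
      show "{\<omega> \<in> space M. dev n \<omega> x > ereal \<tau>} \<in> sets M" if "1 \<le> n" for n
        using meas that x unfolding dev_def by (intro borel_measurable_less measurable_const) auto
      obtain K \<beta> where "0 < K" "0 < \<beta>"
        "\<And>n. 1 \<le> n \<Longrightarrow> \<P>(\<omega> in M. dev n \<omega> x > ereal \<tau>) \<le> K * exp (- (real n * \<beta>))"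
        using saa x unfolding dev_def \<tau>_def by blast
      then show "exp_tail (\<lambda>n. \<P>(\<omega> in M. dev n \<omega> x > ereal \<tau>))"
        by (rule exp_tail_linear_rate)
    qed
    have bad_B: "exp_unlikely M (\<lambda>n \<omega>. sqrt (avg n (\<lambda>i. (op_norm (matrix_inv (Qs (xs i \<omega>))))\<^sup>2)) > B)"
      unfolding B_def
      by (intro exp_unlikelyI Qs_inv_tail[OF zero_less_one] borel_measurable_less measurable_compose[OF _ borel_measurable_sqrt]
          borel_measurable_times borel_measurable_sum borel_measurable_power measurable_const measurable_facts) auto
    have bad_C: "exp_unlikely M (\<lambda>n \<omega>. root 4 (avg n (\<lambda>i. op_norm (Qs (xs i \<omega>)) ^ 4)) > C)"
      unfolding C_def
      by (intro exp_unlikelyI Qs_tail[OF zero_less_one] borel_measurable_less measurable_compose[OF _ borel_measurable_root]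
          borel_measurable_times borel_measurable_sum borel_measurable_power measurable_const measurable_facts) auto
    have bad_E1: "exp_unlikely M (\<lambda>n \<omega>. avg n (\<lambda>i. norm (residual fs Qs (ys i \<omega>) (xs i \<omega>))) > E1)"
      unfolding E1_def
      by (intro exp_unlikelyI eps_tail1[OF zero_less_one] borel_measurable_less measurable_compose[OF _ borel_measurable_norm]
          borel_measurable_times borel_measurable_sum measurable_const measurable_facts) auto
    have bad_E4: "exp_unlikely M (\<lambda>n \<omega>. root 4 (avg n (\<lambda>i. norm (residual fs Qs (ys i \<omega>) (xs i \<omega>)) ^ 4)) > E4)"
      unfolding E4_def
      by (intro exp_unlikelyI eps_tail4[OF zero_less_one] borel_measurable_less measurable_compose[OF _ borel_measurable_root]
          measurable_compose[OF _ borel_measurable_norm] borel_measurable_times borel_measurable_sum borel_measurable_power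
          measurable_const measurable_facts) auto
    have bad_fx: "exp_unlikely M (\<lambda>n \<omega>. norm (fs x - fh n (sample ys xs n \<omega>) x) > \<tau>)"
    proof (rule exp_unlikelyI)
      show "exp_tail (\<lambda>n. \<P>(\<omega> in M. norm (fs x - fh n (sample ys xs n \<omega>) x) > \<tau>))"
        using fhx x by (simp add: \<tau>_def)
    qed (intro borel_measurable_less measurable_compose[OF _ borel_measurable_norm] borel_measurable_diff borel_measurable_const measurable_facts; assumption)
    have bad_Qx: "exp_unlikely M (\<lambda>n \<omega>. op_norm (Qs x - Qh n (sample ys xs n \<omega>) x) > \<tau>)"
    proof (rule exp_unlikelyI)
      show "exp_tail (\<lambda>n. \<P>(\<omega> in M. op_norm (Qs x - Qh n (sample ys xs n \<omega>) x) > \<tau>))"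
        using Qhx x by (simp add: \<tau>_def)
    qed (intro borel_measurable_less borel_measurable_diff borel_measurable_const measurable_facts; assumption)
    have bad_fd: "exp_unlikely M (\<lambda>n \<omega>.
        avg n (\<lambda>i. (norm (fs (xs i \<omega>) - fh n (sample ys xs n \<omega>) (xs i \<omega>)))\<^sup>2) > \<tau>\<^sup>2)"
      by (intro exp_unlikelyI fh_mean_square[OF \<tau>(1)] borel_measurable_less measurable_compose[OF _ borel_measurable_norm]
          borel_measurable_times borel_measurable_sum borel_measurable_power borel_measurable_diff
          measurable_const measurable_facts) auto
    have bad_Qd: "exp_unlikely M (\<lambda>n \<omega>. avg n (\<lambda>i. (op_norm (matrix_inv (Qh n (sample ys xs n \<omega>) (xs i \<omega>))
        - matrix_inv (Qs (xs i \<omega>))))\<^sup>2) > \<tau>\<^sup>2)"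
      by (intro exp_unlikelyI Qh_inv_mean_square[OF \<tau>(1)] borel_measurable_less
          borel_measurable_times borel_measurable_sum borel_measurable_power borel_measurable_diff
          measurable_const measurable_facts) auto
    note bad = M.exp_unlikely_disj[OF bad_saa M.exp_unlikely_disj[OF bad_B M.exp_unlikely_disj[OF bad_C
      M.exp_unlikely_disj[OF bad_E1 M.exp_unlikely_disj[OF bad_E4 M.exp_unlikely_disj[OF bad_fx
      M.exp_unlikely_disj[OF bad_Qx M.exp_unlikely_disj[OF bad_fd bad_Qd]]]]]]]]

    show "exp_tail (\<lambda>n. \<P>(\<omega> in M. \<eta> \<le> infdist (zh n \<omega> x) (argmin_set \<Z> (\<lambda>z. true_obj c P\<^sub>\<epsilon> fs Qs z x))))"
    proof (rule M.exp_tail_of_unlikely[OF bad])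
      fix n :: nat assume n: "1 \<le> n"
      have opt_n: "AE \<omega> in M. zh n \<omega> x \<in> argmin_set \<Z> (\<lambda>z. er_saa_obj c \<Y> (fh n (sample ys xs n \<omega>))
            (Qh n (sample ys xs n \<omega>)) n (sample ys xs n \<omega>) z x)"
        using opt n x by simp
      have scen_n: "AE \<omega> in M. \<forall>i. 1 \<le> i \<longrightarrow> fs x + Qs x *v residual fs Qs (ys i \<omega>) (xs i \<omega>) \<in> \<Y>"
        unfolding AE_all_countable using scen x by (auto intro!: AE_impI)
      show "AE \<omega> in M. \<eta> \<le> infdist (zh n \<omega> x) (argmin_set \<Z> (\<lambda>z. true_obj c P\<^sub>\<epsilon> fs Qs z x)) \<longrightarrow>
        ereal \<tau> < dev n \<omega> x \<or>
        B < sqrt (avg n (\<lambda>i. (op_norm (matrix_inv (Qs (xs i \<omega>))))\<^sup>2)) \<or>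
        C < root 4 (avg n (\<lambda>i. op_norm (Qs (xs i \<omega>)) ^ 4)) \<or>
        E1 < avg n (\<lambda>i. norm (residual fs Qs (ys i \<omega>) (xs i \<omega>))) \<or>
        E4 < root 4 (avg n (\<lambda>i. norm (residual fs Qs (ys i \<omega>) (xs i \<omega>)) ^ 4)) \<or>
        \<tau> < norm (fs x - fh n (sample ys xs n \<omega>) x) \<or>
        \<tau> < op_norm (Qs x - Qh n (sample ys xs n \<omega>) x) \<or>
        \<tau>\<^sup>2 < avg n (\<lambda>i. (norm (fs (xs i \<omega>) - fh n (sample ys xs n \<omega>) (xs i \<omega>)))\<^sup>2) \<or>
        \<tau>\<^sup>2 < avg n (\<lambda>i. (op_norm (matrix_inv (Qh n (sample ys xs n \<omega>) (xs i \<omega>)) - matrix_inv (Qs (xs i \<omega>))))\<^sup>2)"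
        using opt_n scen_n data_in
      proof eventually_elim
        case (elim \<omega>)
        let ?d = "sample ys xs n \<omega>"
        let ?er = "\<lambda>z. er_saa_obj c \<Y> (fh n ?d) (Qh n ?d) n ?d z x"
        have zh: "zh n \<omega> x \<in> \<Z>" "?er (zh n \<omega> x) \<le> ?er z\<^sub>0"
          using elim(1) z0 by (auto simp: argmin_set_def is_arg_min_linorder)
        show ?case
        proof (rule ccontr, unfold not_imp de_Morgan_disj not_less, elim conjE)
          assume far: "\<eta> \<le> infdist (zh n \<omega> x) (argmin_set \<Z> (\<lambda>z. true_obj c P\<^sub>\<epsilon> fs Qs z x))"
            and dev: "dev n \<omega> x \<le> ereal \<tau>"
            and good: "sqrt (avg n (\<lambda>i. (op_norm (matrix_inv (Qs (xs i \<omega>))))\<^sup>2)) \<le> B"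
              "root 4 (avg n (\<lambda>i. op_norm (Qs (xs i \<omega>)) ^ 4)) \<le> C"
              "avg n (\<lambda>i. norm (residual fs Qs (ys i \<omega>) (xs i \<omega>))) \<le> E1"
              "root 4 (avg n (\<lambda>i. norm (residual fs Qs (ys i \<omega>) (xs i \<omega>)) ^ 4)) \<le> E4"
              "norm (fs x - fh n ?d x) \<le> \<tau>"
              "op_norm (Qs x - Qh n ?d x) \<le> \<tau>"
              "avg n (\<lambda>i. (norm (fs (xs i \<omega>) - fh n ?d (xs i \<omega>)))\<^sup>2) \<le> \<tau>\<^sup>2"
              "avg n (\<lambda>i. (op_norm (matrix_inv (Qh n ?d (xs i \<omega>)) - matrix_inv (Qs (xs i \<omega>))))\<^sup>2) \<le> \<tau>\<^sup>2"
          \<comment> \<open>On the complement of the bad events the empirical objective is uniformly close to the true one,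
            so its minimiser cannot lie on the far side of the gap.\<close>
          have close: "\<bar>?er z - g z\<bar> \<le> \<tau> * W + \<tau>" if z: "z \<in> \<Z>" for z
          proof -
            have "\<bar>?er z - saa_obj c fs Qs n ?d z x\<bar> \<le> \<tau> * W"
              unfolding W_def
            proof (rule er_saa_obj_error_uniform[OF closed_Y Y_support_convex])
              show "\<bar>c z y' - c z y\<bar> \<le> l * norm (y' - y)" if "y \<in> \<Y>" "y' \<in> \<Y>" for y y'
                using lip[OF z that] .
              show "invertible (Qs (snd (?d i)))" if "i \<in> {1..n}" for i
                using that elim(3) by (simp add: sample_nth Qs_pos_definite pos_definite_imp_invertible)
            qed (use elim(2) good \<tau> n l(1) in \<open>simp_all add: sample_nth cong: sum.cong_simp\<close>)
            moreover have "ereal \<bar>saa_obj c fs Qs n ?d z x - g z\<bar> \<le> ereal \<tau>"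
              using SUP_upper[OF z] dev unfolding dev_def g_def by (rule order_trans)
            ultimately show ?thesis
              by simp
          qed
          have "g z\<^sub>0 + \<kappa> \<le> g (zh n \<omega> x)"
            using growth[OF zh(1)] far unfolding g_def by blast
          with close[OF zh(1)] close[OF z0] zh(2) small show False
            by linarith
        qed
      qed
    qed
  qed
  then show ?thesis
    unfolding exp_tail_def .
qed

end
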